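(* Let $T>0$, $\underline v>0$, $v\in L^\infty(\mathbb R;\mathbb R_{\ge \underline v})$, $\lambda\in L^\infty((0,T);W^{1,\infty}(\mathbb R))$ and $x_0\in\mathbb R$. Every solution in the integral sense of the initial value problem $x'(t)=v(x(t))\lambda(t,x(t))$, $x(0)=x_0$, on $[0,T]$ is a Filippov solution of this problem.
   Context: $L^\infty(\mathbb R;\mathbb R_{\ge\underline v})$ is the set of essentially bounded measurable functions on $\mathbb R$ with values in $[\underline v,\infty)$. Solution in the integral sense: a function $x\in C([0,T])$ with $$\int_{x_0}^{x(t)}\frac{1}{v(y)}\,dy=\int_0^t\lambda(s,x(s))\,ds\qquad\forall t\in[0,T].$$ Filippov solution: a function $x\in W^{1,1}((0,T))$ with $x(0)=x_0$ and $x'(t)\in K[f(t,\cdot)](x(t))$ for a.e. $t\in[0,T]$, where $f(t,y):=v(y)\lambda(t,y)$ and $$K[f(t,\cdot)](x):=\bigcap_{\delta>0}\ \bigcap_{N\subset\mathbb R,\ \mu(N)=0}\overline{\operatorname{conv}}\, f\big(t,B_\delta(x)\setminus N\big),$$ with $\mu$ the Lebesgue measure on $\mathbb R$, $B_\delta(x)$ the ball of radius $\delta$ around $x$, and $\overline{\operatorname{conv}}$ the closed convex hull. *)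

theory Defs
  imports "HOL-Analysis.Analysis" "HOL-Probability.Essential_Supremum"
begin

section \<open>Lebesgue and Sobolev spaces on the real line\<close>

text \<open>
  Elements of $L^\infty$ and $W^{1,1}$ are represented by functions, not by equivalence
  classes; pointwise conditions on them are therefore imposed almost everywhere only.
\<close>

definition Linf_norm :: "real measure \<Rightarrow> (real \<Rightarrow> real) \<Rightarrow> ereal" where
  "Linf_norm M f = esssup M (\<lambda>x. ereal \<bar>f x\<bar>)"

definition Linf :: "real measure \<Rightarrow> (real \<Rightarrow> real) set" where
  "Linf M = {f \<in> borel_measurable M. Linf_norm M f < \<infinity>}"

text \<open>$C_c^\infty(S)$ for an open set $S$.\<close>

definition test_functions :: "real set \<Rightarrow> (real \<Rightarrow> real) set" where
  "test_functions S = {\<phi>. (\<forall>n x. ((deriv ^^ n) \<phi>) differentiable (at x)) \<and>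
     compact (closure {x. \<phi> x \<noteq> 0}) \<and> closure {x. \<phi> x \<noteq> 0} \<subseteq> S}"

definition locally_integrable :: "real set \<Rightarrow> (real \<Rightarrow> real) \<Rightarrow> bool" where
  "locally_integrable S u \<longleftrightarrow> (\<forall>K. compact K \<and> K \<subseteq> S \<longrightarrow> set_integrable lebesgue K u)"

definition has_weak_derivative :: "real set \<Rightarrow> (real \<Rightarrow> real) \<Rightarrow> (real \<Rightarrow> real) \<Rightarrow> bool" where
  "has_weak_derivative S u g \<longleftrightarrow> locally_integrable S u \<and> locally_integrable S g \<and>
     (\<forall>\<phi>\<in>test_functions S.
        (LINT x:S|lebesgue. (u x * deriv \<phi> x)) = - (LINT x:S|lebesgue. (g x * \<phi> x)))"

text \<open>
  Every class in $W^{1,\infty}(\mathbb{R})$ has exactly one continuous representative, and it is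
  this one that gives $\lambda(s, x(s))$ its meaning. So $W^{1,\infty}(\mathbb{R})$ is modelled
  by these representatives.
\<close>

definition W1inf :: "(real \<Rightarrow> real) set" where
  "W1inf = {u. continuous_on UNIV u \<and> u \<in> Linf lebesgue \<and>
     (\<exists>g\<in>Linf lebesgue. has_weak_derivative UNIV u g)}"

text \<open>
  Weak derivatives are unique almost everywhere, so the infimum ranges over a single value and
  merely selects the weak derivative.
\<close>

definition W1inf_norm :: "(real \<Rightarrow> real) \<Rightarrow> ereal" where
  "W1inf_norm u = Linf_norm lebesgue u +
     (INF g\<in>{g. has_weak_derivative UNIV u g}. Linf_norm lebesgue g)"

text \<open>
  The Bochner space $L^\infty((0,T); W^{1,\infty}(\mathbb{R}))$: strongly measurable functions,
  that is, almost everywhere limits in norm of simple functions, with essentially bounded norm.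
\<close>

definition strongly_measurable_W1inf :: "real measure \<Rightarrow> (real \<Rightarrow> real \<Rightarrow> real) \<Rightarrow> bool" where
  "strongly_measurable_W1inf M l \<longleftrightarrow>
     (\<exists>s. (\<forall>n::nat. simple_function M (s n) \<and> s n ` space M \<subseteq> W1inf) \<and>
        (AE t in M. (\<lambda>n. W1inf_norm (\<lambda>y. s n t y - l t y)) \<longlonglongrightarrow> 0))"

definition Linf_W1inf :: "real \<Rightarrow> (real \<Rightarrow> real \<Rightarrow> real) set" where
  "Linf_W1inf T = {l.
     (AE t in lebesgue_on {0<..<T}. l t \<in> W1inf) \<and>
     strongly_measurable_W1inf (lebesgue_on {0<..<T}) l \<and>
     (\<exists>C::real. AE t in lebesgue_on {0<..<T}. W1inf_norm (l t) \<le> ereal C)}"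

section \<open>Notions of solution\<close>

text \<open>
  The interval integral is oriented, as needed for $x(t) < x_0$.
\<close>

definition integral_solution ::
  "real \<Rightarrow> (real \<Rightarrow> real) \<Rightarrow> (real \<Rightarrow> real \<Rightarrow> real) \<Rightarrow> real \<Rightarrow> (real \<Rightarrow> real) \<Rightarrow> bool" where
  "integral_solution T v l x0 x \<longleftrightarrow> continuous_on {0..T} x \<and>
     (\<forall>t\<in>{0..T}. (LINT y=ereal x0..ereal (x t)|lebesgue. (1 / v y))
                 = (LINT s=ereal 0..ereal t|lebesgue. l s (x s)))"

definition filippov_hull :: "(real \<Rightarrow> real) \<Rightarrow> real \<Rightarrow> real set" where
  "filippov_hull g x =
     (\<Inter>\<delta>\<in>{0<..}. \<Inter>N\<in>null_sets lebesgue. closure (convex hull (g ` (ball x \<delta> - N))))"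

text \<open>
  A function in $W^{1,1}((0,T))$ is represented by its continuous extension to $[0,T]$, so that
  the initial value is meaningful; \<open>x'\<close> is the weak derivative.
\<close>

definition filippov_solution ::
  "real \<Rightarrow> (real \<Rightarrow> real \<Rightarrow> real) \<Rightarrow> real \<Rightarrow> (real \<Rightarrow> real) \<Rightarrow> bool" where
  "filippov_solution T f x0 x \<longleftrightarrow> continuous_on {0..T} x \<and> x 0 = x0 \<and>
     set_integrable lebesgue {0<..<T} x \<and>
     (\<exists>x'. set_integrable lebesgue {0<..<T} x' \<and> has_weak_derivative {0<..<T} x x' \<and>
        (AE t in lebesgue_on {0..T}. x' t \<in> filippov_hull (f t) (x t)))"

end

theory Submission
  imports Defs
begin

text \<open>
  With $W(z) = \int_{x_0}^z 1/v$ and $G(t) = \int_0^t \lambda(s,x(s))\,ds$ the integral equation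
  reads $W \circ x = G$. Since $W$ is bi-Lipschitz and $G$ is Lipschitz, $x$ is Lipschitz and thus
  weakly differentiable with $x'$ its almost everywhere pointwise derivative.
  If $c = x'(t)$ were outside the closed convex hull for some $\delta$ and $N$, a linear functional
  $a$ would give $a\,v\,\lambda(t,x(t)) \ge k > a c$ almost everywhere near $x(t)$, by continuity of
  $\lambda(t,\cdot)$. Dividing by $v$ and integrating from $x(t)$ to $x(s)$ compares the increments of
  $x$ with those of $W \circ x$; in the limit $s \to t$ this forces $G'(t) = \lambda(t,x(t)) = 0$,
  hence $c = 0$ and $0 \ge k > 0$, a contradiction.
\<close>

section \<open>Differentiation of indefinite integrals and densities of Lipschitz functions\<close>

text \<open>Lebesgue's differentiation theorem for averages over cubes with lower corner at the
  point; on the line such averages are right difference quotients only.\<close>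

lemma ae_has_derivative_right:
  fixes g u :: "real \<Rightarrow> real"
  assumes g: "\<And>a b. a \<le> b \<Longrightarrow> (g has_integral (u b - u a)) {a..b}"
  obtains N where "negligible N"
    "\<And>t. t \<notin> N \<Longrightarrow> ((\<lambda>h. (u (t + h) - u t) / h) \<longlongrightarrow> g t) (at_right 0)"
proof -
  have int: "g integrable_on cbox a b" for a b
    using g[of a b] by (cases "a \<le> b") auto
  obtain N where N: "negligible N" "\<And>x e. \<lbrakk>x \<notin> N; 0 < e\<rbrakk> \<Longrightarrow>
       \<exists>d>0. \<forall>h. 0 < h \<and> h < d \<longrightarrow> norm (integral (cbox x (x + h *\<^sub>R One)) g /\<^sub>R h ^ DIM(real) - g x) < e"
    using integrable_ccontinuous_explicit[OF int] by metis
  show ?thesis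
  proof (rule that[OF N(1)])
    fix t assume t: "t \<notin> N"
    show "((\<lambda>h. (u (t + h) - u t) / h) \<longlongrightarrow> g t) (at_right 0)"
    proof (rule tendstoI)
      fix e :: real assume "0 < e"
      from N(2)[OF t this] obtain d where d: "d > 0"
        "\<And>h. 0 < h \<Longrightarrow> h < d \<Longrightarrow> norm (integral (cbox t (t + h *\<^sub>R One)) g /\<^sub>R h ^ DIM(real) - g t) < e"
        by blast
      have "dist ((u (t + h) - u t) / h) (g t) < e" if "0 < h" "h < d" for h
        using d(2)[OF that] integral_unique[OF g[of t "t + h"]] that
        by (simp add: dist_real_def divide_inverse mult.commute)
      then show "\<forall>\<^sub>F h in at_right 0. dist ((u (t + h) - u t) / h) (g t) < e"
        using d(1) by (auto simp: eventually_at_right)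
    qed
  qed
qed

text \<open>Reflection at the origin turns left difference quotients of \<open>u\<close> into right
  ones of \<open>\<lambda>s. - u (- s)\<close>, so the one-sided result is applied twice and the
  second exceptional set is reflected back.\<close>

lemma ae_has_derivative_indefinite_integral:
  fixes g u :: "real \<Rightarrow> real"
  assumes g: "\<And>a b. a \<le> b \<Longrightarrow> (g has_integral (u b - u a)) {a..b}"
  obtains N where "negligible N" "\<And>t. t \<notin> N \<Longrightarrow> (u has_real_derivative g t) (at t)"
proof -
  obtain N where N: "negligible N"
    "\<And>t. t \<notin> N \<Longrightarrow> ((\<lambda>h. (u (t + h) - u t) / h) \<longlongrightarrow> g t) (at_right 0)"
    using ae_has_derivative_right[OF g] by metis
  have g': "((\<lambda>s. g (- s)) has_integral (- u (- b) - - u (- a))) {a..b}" if "a \<le> b" for a b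
    using g[of "-b" "-a"] has_integral_reflect_real[of "\<lambda>s. g (- s)" "u (- a) - u (- b)" b a] that by simp
  obtain M where M: "negligible M"
    "\<And>t. t \<notin> M \<Longrightarrow> ((\<lambda>h. (- u (- (t + h)) - - u (- t)) / h) \<longlongrightarrow> g (- t)) (at_right 0)"
    using ae_has_derivative_right[OF g'] by metis
  have "negligible (N \<union> uminus ` M)"
    using N(1) M(1)
    by (intro negligible_Un negligible_differentiable_image_negligible) (auto intro!: derivative_intros)
  moreover have "(u has_real_derivative g t) (at t)" if "t \<notin> N \<union> uminus ` M" for t
  proof -
    have "- t \<notin> M" using that by force
    from M(2)[OF this] have "((\<lambda>h. (u (t - h) - u t) / - h) \<longlongrightarrow> g t) (at_right 0)"
      by (simp add: diff_divide_distrib)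
    then have "((\<lambda>h. (u (t + h) - u t) / h) \<longlongrightarrow> g t) (at_left 0)"
      by (subst at_left_minus) (simp add: filterlim_filtermap)
    moreover have "((\<lambda>h. (u (t + h) - u t) / h) \<longlongrightarrow> g t) (at_right 0)"
      using that N(2) by auto
    ultimately show ?thesis
      by (simp add: DERIV_def filterlim_at_split)
  qed
  ultimately show ?thesis using that by blast
qed

text \<open>Makes the fundamental theorem of calculus available for Lipschitz functions: it serves
  the solution itself and its products with test functions.\<close>

lemma lipschitz_density:
  fixes u :: "real \<Rightarrow> real"
  assumes u: "C-lipschitz_on UNIV u"
  obtains g where "\<And>a b. a \<le> b \<Longrightarrow> (g has_integral (u b - u a)) {a..b}"
    "\<And>a b. g absolutely_integrable_on {a..b}"
proof -
  \<comment> \<open>a bi-Lipschitz increasing function: the image of \<open>lborel\<close> under its inverse measures an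
    interval by the increment of \<open>F\<close>, and its Radon--Nikodym density is that of \<open>u\<close> up to a constant\<close>
  define F where "F = (\<lambda>t. u t + (C + 1) * t)"
  have ub: "\<bar>u b - u a\<bar> \<le> C * (b - a)" if "a \<le> b" for a b
    using lipschitz_onD[OF u, of b a] that by (simp add: dist_real_def)
  \<comment> \<open>The slope \<open>C + 1\<close> exceeds the Lipschitz constant by one, so
    difference quotients of \<open>F\<close> lie between \<open>1\<close> and
    \<open>2 * C + 1\<close>.\<close>
  have F1: "b - a \<le> F b - F a" if "a \<le> b" for a b
    using ub[OF that] by (simp add: F_def algebra_simps)
  have F2: "F b - F a \<le> (2 * C + 1) * (b - a)" if "a \<le> b" for a b
    using ub[OF that] by (simp add: F_def algebra_simps)
  have F3: "\<bar>F b - F a\<bar> \<le> (2 * C + 1) * \<bar>b - a\<bar>" for a b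
    using F1[of a b] F2[of a b] F1[of b a] F2[of b a] by (cases "a \<le> b") auto
  have F4: "\<bar>b - a\<bar> \<le> \<bar>F b - F a\<bar>" for a b
    using F1[of a b] F1[of b a] by (cases "a \<le> b") auto
  have le_iff: "F a \<le> F b \<longleftrightarrow> a \<le> b" for a b
    using F1[of a b] F1[of b a] by (cases "a \<le> b") auto
  have inj: "inj F" by (rule injI) (metis le_iff order_antisym order_refl)
  have cont: "continuous_on UNIV F"
    unfolding F_def using lipschitz_on_continuous_on[OF u] by (intro continuous_intros)
  have surj: "\<exists>t. F t = y" for y
  proof -
    let ?n = "\<bar>y - F 0\<bar>"
    have "F (- ?n) \<le> y" "y \<le> F ?n" using F1[of 0 ?n] F1[of "- ?n" 0] by auto
    then show ?thesis
      using IVT'[of F "- ?n" y ?n] cont continuous_on_subset by (metis abs_ge_zero neg_le_0_iff_le order_trans subset_UNIV)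
  qed
  define G where "G = inv F"
  have FG: "F (G y) = y" for y using surj by (metis G_def f_inv_into_f rangeI)
  have GF: "G (F t) = t" for t by (simp add: G_def inj)
  have "1-lipschitz_on UNIV G"
    using F4 FG by (auto intro!: lipschitz_onI simp: dist_real_def) (metis FG)
  then have "continuous_on UNIV G" by (rule lipschitz_on_continuous_on)
  then have Gm [measurable]: "G \<in> borel_measurable borel"
    by (rule borel_measurable_continuous_onI)
  define M where "M = distr lborel borel G"
  \<comment> \<open>The preimage of \<open>A\<close> under \<open>G\<close> is the image of
    \<open>A\<close> under \<open>F\<close>, and Lipschitz maps send null sets of the line to null
    sets.\<close>
  have "absolutely_continuous lborel M"
    unfolding absolutely_continuous_def
  proof
    fix A :: "real set" assume A: "A \<in> null_sets lborel"
    then have "negligible A"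
      using negligible_iff_null_sets null_sets_completionI by blast
    then have "negligible (F ` A)"
      by (rule negligible_locally_Lipschitz_image[OF order_refl])
        (use F3 in \<open>auto intro!: exI[of _ UNIV] exI[of _ "2 * C + 1"] simp: dist_real_def\<close>)
    moreover have "G -` A = F ` A"
      using FG GF by (auto simp: image_iff) (metis FG)
    moreover have "G -` A \<in> sets borel"
      using measurable_sets[OF Gm, of A] A by auto
    ultimately have "emeasure lborel (G -` A) = 0"
      by (simp add: negligible_iff_emeasure0 sets_completionI_sets)
    then show "A \<in> null_sets M"
      using A by (auto simp: M_def null_sets_def emeasure_distr)
  qed
  from sigma_finite_measure.Radon_Nikodym[OF lborel.sigma_finite_measure_axioms this] obtain f
    where f [measurable]: "f \<in> borel_measurable borel" and M: "density lborel f = M"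
    by (auto simp: M_def)
  have nn: "(\<integral>\<^sup>+ t. f t * indicator {a..b} t \<partial>lborel) = ennreal (F b - F a)" if "a \<le> b" for a b
  proof -
    have "G -` {a..b} = {F a..F b}"
      using le_iff FG GF by (auto) (metis FG le_iff)+
    then have "emeasure M {a..b} = ennreal (F b - F a)"
      using that le_iff by (simp add: M_def emeasure_distr)
    then show ?thesis by (simp add: M[symmetric] emeasure_density)
  qed
  \<comment> \<open>The density has finite integral over bounded intervals, hence is finite almost
    everywhere, and \<open>enn2real\<close> changes no integral.\<close>
  define e where "e = (\<lambda>t. enn2real (f t))"
  have [measurable]: "e \<in> borel_measurable borel" by (simp add: e_def)
  have he: "has_bochner_integral lborel (\<lambda>t. indicator {a..b} t * e t) (F b - F a)" if "a \<le> b" for a b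
  proof (rule has_bochner_integral_nn_integral)
    have "AE t in lborel. f t * indicator {a..b} t \<noteq> \<infinity>"
      by (rule nn_integral_PInf_AE) (auto simp: nn[OF that])
    then have "(\<integral>\<^sup>+ t. ennreal (indicator {a..b} t * e t) \<partial>lborel) = (\<integral>\<^sup>+ t. f t * indicator {a..b} t \<partial>lborel)"
      by (intro nn_integral_cong_AE) (auto elim!: eventually_mono simp: e_def indicator_def less_top)
    then show "(\<integral>\<^sup>+ t. ennreal (indicator {a..b} t * e t) \<partial>lborel) = ennreal (F b - F a)"
      by (simp add: nn[OF that])
  qed (use that le_iff in \<open>auto simp: e_def\<close>)
  have abs: "e absolutely_integrable_on {a..b}" for a b
  proof (cases "a \<le> b")
    case True
    then have "set_integrable lborel {a..b} e"
      using he[OF True] by (auto simp: set_integrable_def has_bochner_integral_iff)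
    then show ?thesis by (simp add: set_integrable_def integrable_completion)
  qed (simp add: set_integrable_def)
  have hi: "(e has_integral (F b - F a)) {a..b}" if "a \<le> b" for a b
  proof -
    have "set_integrable lborel {a..b} e" "(LINT t:{a..b}|lborel. e t) = F b - F a"
      using he[OF that] by (auto simp: set_integrable_def set_lebesgue_integral_def has_bochner_integral_iff)
    then show ?thesis
      using set_borel_integral_eq_integral[of "{a..b}" e] by (metis integrable_integral)
  qed
  show ?thesis
  proof (rule that[of "\<lambda>t. e t - (C + 1)"])
    show "((\<lambda>t. e t - (C + 1)) has_integral (u b - u a)) {a..b}" if "a \<le> b" for a b
      using has_integral_diff[OF hi[OF that] has_integral_const_real[of "C + 1" a b]] that
      by (simp add: F_def algebra_simps)
    show "(\<lambda>t. e t - (C + 1)) absolutely_integrable_on {a..b}" for a b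
      by (intro set_integral_diff abs) simp
  qed
qed

section \<open>The Filippov inclusion at a single point of time\<close>

text \<open>
  The integrated hypothesis reverses its direction where $p(s) < p(t)$; multiplying by the increment of
  $W \circ p$, which has the sign of $p(s) - p(t)$, makes it independent of the orientation.
\<close>

lemma oriented_increment_derivative_nonneg:
  fixes p W w :: "real \<Rightarrow> real"
  assumes W: "\<And>a b. a \<le> b \<Longrightarrow> (w has_integral (W b - W a)) {a..b}"
    and w: "\<And>y. 0 \<le> w y"
    and N: "negligible N" and \<delta>: "0 < \<delta>"
    and le: "\<And>y. y \<in> ball (p t) \<delta> - N \<Longrightarrow> k * w y \<le> m"
    and p: "(p has_real_derivative c) (at t)"
    and Wp: "((\<lambda>s. W (p s)) has_real_derivative h) (at t)"
  shows "0 \<le> (m * c - k * h) * h"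
proof -
  have mono: "W a \<le> W b" if "a \<le> b" for a b
    using has_integral_nonneg[OF W[OF that]] w by auto
  have incr: "k * (W b - W a) \<le> m * (b - a)"
    if "a \<le> b" "a \<in> ball (p t) \<delta>" "b \<in> ball (p t) \<delta>" for a b
  proof -
    have sub: "y \<in> ball (p t) \<delta>" if "y \<in> {a..b}" for y
      using that \<open>a \<in> _\<close> \<open>b \<in> _\<close> by (auto simp: dist_real_def)
    have "((\<lambda>y. k * w y) has_integral k * (W b - W a)) {a..b}"
      using has_integral_mult_right[OF W[OF \<open>a \<le> b\<close>]] .
    \<comment> \<open>Resetting the integrand to \<open>m\<close> on \<open>N\<close> makes the
      bound hold at every point of the interval, as the comparison of integrals requires.\<close>
    then have 1: "((\<lambda>y. if y \<in> N then m else k * w y) has_integral k * (W b - W a)) {a..b}"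
      by (rule has_integral_spike[OF N, rotated]) auto
    have "((\<lambda>y. m) has_integral (b - a) * m) {a..b}"
      using has_integral_const_real[of m a b] \<open>a \<le> b\<close> by simp
    from has_integral_le[OF 1 this] show ?thesis
      using le sub by (auto simp: mult.commute)
  qed
  let ?D = "\<lambda>s. (p s - p t) / (s - t)" and ?E = "\<lambda>s. (W (p s) - W (p t)) / (s - t)"
  have D: "(?D \<longlongrightarrow> c) (at t)" and E: "(?E \<longlongrightarrow> h) (at t)"
    using p Wp by (auto simp: has_field_derivative_iff)
  have "((\<lambda>s. (m * ?D s - k * ?E s) * ?E s) \<longlongrightarrow> (m * c - k * h) * h) (at t)"
    by (intro tendsto_intros D E)
  moreover have "\<forall>\<^sub>F s in at t. 0 \<le> (m * ?D s - k * ?E s) * ?E s"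
  proof -
    have "\<forall>\<^sub>F s in at t. dist (p s) (p t) < \<delta>"
      using DERIV_isCont[OF p] \<delta> by (simp add: isCont_def tendsto_iff)
    then show ?thesis
    proof eventually_elim
      case (elim s)
      define d e where "d = p s - p t" and "e = W (p s) - W (p t)"
      have "0 \<le> (m * d - k * e) * e"
      proof (cases "p t \<le> p s")
        case True
        with elim incr[of "p t" "p s"] mono[OF True] \<delta> show ?thesis
          by (auto simp: d_def e_def dist_commute intro!: mult_nonneg_nonneg)
      next
        case False
        then have "k * (W (p t) - W (p s)) \<le> m * (p t - p s)"
          using elim \<delta> by (intro incr) (auto simp: dist_commute)
        moreover have "W (p s) \<le> W (p t)" using False mono by auto
        ultimately show ?thesis
          by (intro mult_nonpos_nonpos) (auto simp: d_def e_def algebra_simps)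
      qed
      \<comment> \<open>Dividing by a square keeps the sign on both sides of \<open>t\<close> and
        distributes one factor \<open>s - t\<close> to each difference quotient.\<close>
      then have "0 \<le> (m * d - k * e) * e / (s - t)\<^sup>2" by simp
      also have "\<dots> = (m * ?D s - k * ?E s) * ?E s"
        unfolding d_def[symmetric] e_def[symmetric]
        by (simp only: power2_eq_square times_divide_times_eq[symmetric] diff_divide_distrib times_divide_eq_right)
      finally show ?case .
    qed
  qed
  ultimately show ?thesis
    by (rule tendsto_lowerbound) simp
qed

text \<open>The function \<open>w\<close> stands for the reciprocal of \<open>v\<close>, and the
  derivative of \<open>W\<close> composed with \<open>p\<close> stands for the differential
  equation. \<open>W\<close> need not be differentiable at \<open>p t\<close>, so the chain rule
  cannot recover \<open>c\<close>; a separating functional is used instead.\<close>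

lemma derivative_in_filippov_hull:
  fixes p W w v l :: "real \<Rightarrow> real"
  assumes W: "\<And>a b. a \<le> b \<Longrightarrow> (w has_integral (W b - W a)) {a..b}"
    and w: "\<And>y. 0 < w y"
    and N: "negligible N" and v: "\<And>y. y \<notin> N \<Longrightarrow> w y * v y = 1 \<and> \<bar>v y\<bar> \<le> V"
    and lip: "\<And>a b. \<bar>b - a\<bar> \<le> V * \<bar>W b - W a\<bar>"
    and p: "(p has_real_derivative c) (at t)"
    and Wp: "((\<lambda>s. W (p s)) has_real_derivative l (p t)) (at t)"
    and l: "isCont l (p t)"
  shows "c \<in> filippov_hull (\<lambda>y. v y * l y) (p t)"
  unfolding filippov_hull_def
proof (intro INT_I)
  fix \<delta> :: real and M :: "real set" assume "\<delta> \<in> {0<..}" and M: "M \<in> null_sets lebesgue"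
  then have \<delta>: "\<delta> > 0" by simp
  let ?S = "(\<lambda>y. v y * l y) ` (ball (p t) \<delta> - M)"
  let ?h = "l (p t)"
  show "c \<in> closure (convex hull ?S)"
  proof (rule ccontr)
    assume "c \<notin> closure (convex hull ?S)"
    then obtain a b where ab: "a * c < b" "\<And>s. s \<in> closure (convex hull ?S) \<Longrightarrow> b < a * s"
      using separating_hyperplane_closed_point[of "closure (convex hull ?S)" c]
      by (auto simp: convex_closure convex_convex_hull)
    have S: "b < a * (v y * l y)" if "y \<in> ball (p t) \<delta> - M" for y
      using that by (intro ab(2) subsetD[OF closure_subset] hull_inc) auto
    \<comment> \<open>Half of the gap between \<open>a * c\<close> and \<open>b\<close> pays for
      replacing \<open>l y\<close> by \<open>l (p t)\<close>; the other half keeps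
      \<open>a * c < k\<close> strict.\<close>
    define k where "k = (a * c + b) / 2"
    have k: "a * c < k" "k < b" using ab(1) by (auto simp: k_def)
    have "\<forall>\<^sub>F y in nhds (p t). dist (V * \<bar>a\<bar> * \<bar>l y - ?h\<bar>) 0 < b - k"
    proof -
      have "((\<lambda>y. V * \<bar>a\<bar> * \<bar>l y - ?h\<bar>) \<longlongrightarrow> V * \<bar>a\<bar> * \<bar>?h - ?h\<bar>) (nhds (p t))"
        using l by (intro tendsto_intros) (simp add: isCont_def tendsto_at_iff_tendsto_nhds)
      from tendstoD[OF this, of "b - k"] k show ?thesis by simp
    qed
    then obtain \<epsilon> where \<epsilon>: "\<epsilon> > 0" "\<And>y. dist y (p t) < \<epsilon> \<Longrightarrow> \<bar>V * \<bar>a\<bar> * \<bar>l y - ?h\<bar>\<bar> < b - k"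
      by (auto simp: eventually_nhds_metric)
    define r where "r = min \<delta> \<epsilon>"
    have r: "r > 0" using \<delta> \<epsilon> by (simp add: r_def)
    have negl: "negligible (N \<union> M)"
      using N M by (metis negligible_Un negligible_iff_null_sets)
    \<comment> \<open>The factor \<open>v y\<close> is cancelled by \<open>w y\<close>, which leaves
      a right-hand side independent of \<open>y\<close> and a left-hand side with primitive
      \<open>k * W\<close>.\<close>
    have le: "k * w y \<le> a * ?h" if "y \<in> ball (p t) r - (N \<union> M)" for y
    proof -
      have "\<bar>V * \<bar>a\<bar> * \<bar>l y - ?h\<bar>\<bar> < b - k"
        using that by (intro \<epsilon>) (auto simp: r_def dist_commute)
      moreover have "\<bar>v y * (a * (l y - ?h))\<bar> \<le> V * (\<bar>a\<bar> * \<bar>l y - ?h\<bar>)"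
        unfolding abs_mult using v[of y] that by (intro mult_right_mono) auto
      moreover have "b < a * (v y * l y)"
        using that by (intro S) (auto simp: r_def)
      ultimately have "k < a * (v y * ?h)"
        by (simp add: algebra_simps)
      then have "k * w y \<le> a * (v y * ?h) * w y"
        using w[of y] by (intro mult_right_mono) auto
      also have "\<dots> = a * ?h * (w y * v y)" by simp
      also have "\<dots> = a * ?h" using v[of y] that by simp
      finally show ?thesis .
    qed
    \<comment> \<open>With \<open>m\<close> equal to \<open>a * l (p t)\<close> the conclusion
      becomes \<open>a * c - k\<close>, which is negative, times the square of
      \<open>l (p t)\<close>; hence \<open>l (p t)\<close> vanishes.\<close>
    have "0 \<le> (a * ?h * c - k * ?h) * ?h"
      by (rule oriented_increment_derivative_nonneg[OF W _ negl r le p Wp]) (use w less_imp_le in auto)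
    also have "\<dots> = (a * c - k) * (?h * ?h)" by (simp add: algebra_simps)
    finally have h0: "?h = 0"
      using k(1) by (auto simp: zero_le_mult_iff mult_le_0_iff)
    \<comment> \<open>The bound \<open>lip\<close> controls the quotients of \<open>p\<close> by
      those of \<open>W\<close> composed with \<open>p\<close>; in the limit a vanishing
      \<open>l (p t)\<close> forces \<open>c = 0\<close>.\<close>
    have "\<bar>c\<bar> \<le> V * \<bar>?h\<bar>"
    proof (rule tendsto_le)
      show "((\<lambda>s. V * \<bar>(W (p s) - W (p t)) / (s - t)\<bar>) \<longlongrightarrow> V * \<bar>?h\<bar>) (at t)"
        using Wp by (intro tendsto_intros) (simp add: has_field_derivative_iff)
      show "((\<lambda>s. \<bar>(p s - p t) / (s - t)\<bar>) \<longlongrightarrow> \<bar>c\<bar>) (at t)"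
        using p by (intro tendsto_intros) (simp add: has_field_derivative_iff)
      show "\<forall>\<^sub>F s in at t. \<bar>(p s - p t) / (s - t)\<bar> \<le> V * \<bar>(W (p s) - W (p t)) / (s - t)\<bar>"
        using lip by (auto simp: abs_divide intro!: always_eventually divide_right_mono)
    qed simp
    then have c0: "c = 0" using h0 by simp
    \<comment> \<open>A ball is not null, so some \<open>y\<close> avoids both exceptional sets.
      There \<open>k * w y \<le> 0\<close>, although \<open>k\<close> exceeds \<open>a * c\<close>,
      which is zero, and \<open>w y\<close> is positive.\<close>
    have "\<not> ball (p t) r \<subseteq> N \<union> M"
      using r negligible_subset[OF negl] open_not_negligible[of "ball (p t) r"] by force
    then obtain y where "y \<in> ball (p t) r - (N \<union> M)" by blast
    from le[OF this] h0 have "k * w y \<le> 0" by simp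
    with w[of y] k(1) c0 show False
      by (simp add: mult_le_0_iff)
  qed
qed

section \<open>Test functions and weak derivatives of Lipschitz functions\<close>

lemma test_function_continuous:
  assumes "\<phi> \<in> test_functions S"
  shows "\<phi> differentiable at s" "continuous_on A \<phi>" "continuous_on A (deriv \<phi>)"
proof -
  have d: "((deriv ^^ n) \<phi>) differentiable at s" for n s
    using assms by (auto simp: test_functions_def)
  show "\<phi> differentiable at s" using d[of 0] by simp
  show "continuous_on A \<phi>"
    using d[of 0] by (auto intro!: continuous_at_imp_continuous_on differentiable_imp_continuous_within)
  show "continuous_on A (deriv \<phi>)"
    using d[of 1] by (auto intro!: continuous_at_imp_continuous_on differentiable_imp_continuous_within)
qed

text \<open>The derivative is continuous and vanishes off the compact support, hence is
  bounded.\<close>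

lemma test_function_lipschitz:
  assumes \<phi>: "\<phi> \<in> test_functions S"
  obtains B where "B-lipschitz_on UNIV \<phi>"
proof -
  define K where "K = closure {s. \<phi> s \<noteq> 0}"
  have K: "compact K" using \<phi> by (simp add: test_functions_def K_def)
  have out: "deriv \<phi> s = 0" if "s \<notin> K" for s
  proof -
    have "\<forall>\<^sub>F r in nhds s. \<phi> r = 0"
      unfolding eventually_nhds
      using that closure_subset[of "{s. \<phi> s \<noteq> 0}"] by (intro exI[of _ "- K"]) (auto simp: K_def)
    then show ?thesis using deriv_cong_ev[of \<phi> "\<lambda>_. 0" s s] by simp
  qed
  have "bounded (deriv \<phi> ` K)"
    using compact_continuous_image[OF test_function_continuous(3)[OF \<phi>] K] compact_imp_bounded by blast
  then obtain B where B: "B > 0" "\<And>s. s \<in> K \<Longrightarrow> \<bar>deriv \<phi> s\<bar> \<le> B"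
    by (auto simp: bounded_pos)
  have "\<bar>deriv \<phi> s\<bar> \<le> B" for s using B out by (cases "s \<in> K") auto
  moreover have "(\<phi> has_real_derivative deriv \<phi> s) (at s)" for s
    using test_function_continuous(1)[OF \<phi>]
    by (metis DERIV_deriv_iff_real_differentiable)
  ultimately have "\<bar>\<phi> r - \<phi> s\<bar> \<le> B * \<bar>r - s\<bar>" for r s
    using field_differentiable_bound[of UNIV \<phi> "deriv \<phi>" B r s] by (auto simp: norm_minus_commute)
  then show ?thesis
    using B(1) by (intro that lipschitz_onI) (auto simp: dist_real_def)
qed

lemma locally_integrableI:
  assumes "\<And>a b. u absolutely_integrable_on {a..b}"
  shows "locally_integrable S u"
  unfolding locally_integrable_def
proof (intro allI impI)
  fix K assume K: "compact K \<and> K \<subseteq> S"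
  then obtain a where "K \<subseteq> cbox (- a) a"
    using bounded_subset_cbox_symmetric compact_imp_bounded by metis
  moreover have "K \<in> sets lebesgue"
    using K lmeasurable_compact fmeasurableD by blast
  ultimately show "set_integrable lebesgue K u"
    using set_integrable_subset[OF assms[of "- a" a]] by simp
qed

text \<open>Products of bounded Lipschitz functions are Lipschitz; \<open>u\<close> may be unbounded
  on the line, but only its values on \<open>K\<close> matter.\<close>

lemma lipschitz_mult_compact_support:
  fixes u \<phi> :: "real \<Rightarrow> real"
  assumes u: "L-lipschitz_on UNIV u" and \<phi>: "B-lipschitz_on UNIV \<phi>"
    and K: "compact K" "\<And>s. s \<notin> K \<Longrightarrow> \<phi> s = 0"
  obtains M where "M-lipschitz_on UNIV (\<lambda>s. u s * \<phi> s)"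
proof -
  have "bounded (u ` K)" "bounded (\<phi> ` K)"
    using u \<phi> K(1)
    by (auto intro!: compact_imp_bounded compact_continuous_image
        intro: lipschitz_on_continuous_on lipschitz_on_subset)
  then obtain U P where U: "U > 0" "\<And>s. s \<in> K \<Longrightarrow> \<bar>u s\<bar> \<le> U"
    and P: "P > 0" "\<And>s. s \<in> K \<Longrightarrow> \<bar>\<phi> s\<bar> \<le> P"
    unfolding bounded_pos by auto
  have P': "\<bar>\<phi> s\<bar> \<le> P" for s using P K by (cases "s \<in> K") auto
  have nonneg: "L \<ge> 0" "B \<ge> 0" using u \<phi> lipschitz_on_nonneg by blast+
  \<comment> \<open>Only \<open>s\<close> has to lie in \<open>K\<close>, because \<open>u\<close>
    appears as a factor at \<open>s\<close> alone and \<open>P\<close> bounds \<open>\<phi>\<close>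
    everywhere. Exchanging \<open>s\<close> and \<open>r\<close> covers the case that
    \<open>r\<close> lies in \<open>K\<close>; if neither does, both products vanish.\<close>
  have *: "\<bar>u s * \<phi> s - u r * \<phi> r\<bar> \<le> (U * B + P * L) * \<bar>s - r\<bar>" if "s \<in> K" for s r
  proof -
    have "\<bar>u s * \<phi> s - u r * \<phi> r\<bar> = \<bar>u s * (\<phi> s - \<phi> r) + \<phi> r * (u s - u r)\<bar>"
      by (simp add: algebra_simps)
    also have "\<dots> \<le> \<bar>u s\<bar> * \<bar>\<phi> s - \<phi> r\<bar> + \<bar>\<phi> r\<bar> * \<bar>u s - u r\<bar>"
      by (metis abs_mult abs_triangle_ineq)
    also have "\<dots> \<le> U * (B * \<bar>s - r\<bar>) + P * (L * \<bar>s - r\<bar>)"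
      using U(2)[OF that] P'[of r] lipschitz_onD[OF u, of s r] lipschitz_onD[OF \<phi>, of s r] U(1) P(1)
      by (intro add_mono mult_mono) (auto simp: dist_real_def)
    finally show ?thesis by (simp add: algebra_simps)
  qed
  have "\<bar>u s * \<phi> s - u r * \<phi> r\<bar> \<le> (U * B + P * L) * \<bar>s - r\<bar>" for s r
    using *[of s r] *[of r s] K(2)[of s] K(2)[of r] nonneg U(1) P(1)
    by (cases "s \<in> K"; cases "r \<in> K") (auto simp: abs_minus_commute)
  then show ?thesis
    using nonneg U(1) P(1) by (intro that[of "U * B + P * L"] lipschitz_onI) (auto simp: dist_real_def)
qed

text \<open>Integration by parts: the product with a test function is Lipschitz, so it has a density
  \<open>q\<close>, which the pointwise product rule identifies almost everywhere.\<close>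

lemma lipschitz_has_weak_derivative:
  fixes u g :: "real \<Rightarrow> real"
  assumes u: "L-lipschitz_on UNIV u"
    and g: "\<And>a b. a \<le> b \<Longrightarrow> (g has_integral (u b - u a)) {a..b}"
    and g_int: "\<And>a b. g absolutely_integrable_on {a..b}"
  shows "has_weak_derivative {a<..<b} u g"
  unfolding has_weak_derivative_def
proof (intro conjI ballI)
  have cont: "continuous_on A u" for A
    using lipschitz_on_continuous_on[OF u] continuous_on_subset by blast
  then show "locally_integrable {a<..<b} u" "locally_integrable {a<..<b} g"
    by (auto intro!: locally_integrableI absolutely_integrable_continuous_real g_int)
  fix \<phi> assume \<phi>: "\<phi> \<in> test_functions {a<..<b}"
  define K where "K = closure {s. \<phi> s \<noteq> 0}"
  have K: "compact K" "K \<subseteq> {a<..<b}" "\<And>s. s \<notin> K \<Longrightarrow> \<phi> s = 0"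
    using \<phi> closure_subset[of "{s. \<phi> s \<noteq> 0}"] by (auto simp: test_functions_def K_def)
  obtain B where B: "B-lipschitz_on UNIV \<phi>" by (rule test_function_lipschitz[OF \<phi>])
  obtain M where "M-lipschitz_on UNIV (\<lambda>s. u s * \<phi> s)"
    by (rule lipschitz_mult_compact_support[OF u B K(1,3)])
  then obtain q where q: "\<And>c d. c \<le> d \<Longrightarrow> (q has_integral (u d * \<phi> d - u c * \<phi> c)) {c..d}"
    by (rule lipschitz_density) blast
  obtain N1 where N1: "negligible N1" "\<And>s. s \<notin> N1 \<Longrightarrow> ((\<lambda>s. u s * \<phi> s) has_real_derivative q s) (at s)"
    using ae_has_derivative_indefinite_integral[OF q] by blast
  obtain N2 where N2: "negligible N2" "\<And>s. s \<notin> N2 \<Longrightarrow> (u has_real_derivative g s) (at s)"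
    using ae_has_derivative_indefinite_integral[OF g] by blast
  have q_eq: "u s * deriv \<phi> s + g s * \<phi> s = q s" if "s \<notin> N1 \<union> N2" for s
  proof -
    have "(\<phi> has_real_derivative deriv \<phi> s) (at s)"
      using test_function_continuous(1)[OF \<phi>] by (metis DERIV_deriv_iff_real_differentiable)
    then have "((\<lambda>s. u s * \<phi> s) has_real_derivative u s * deriv \<phi> s + g s * \<phi> s) (at s)"
      using N2(2)[of s] that DERIV_mult[of u "g s" s UNIV \<phi> "deriv \<phi> s"] by (simp add: algebra_simps)
    then show ?thesis using N1(2)[of s] that DERIV_unique by blast
  qed
  show "(LINT s:{a<..<b}|lebesgue. u s * deriv \<phi> s) = - (LINT s:{a<..<b}|lebesgue. g s * \<phi> s)"
  proof (cases "a < b")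
    case True
    have 1: "set_integrable lebesgue {a<..<b} (\<lambda>s. u s * deriv \<phi> s)"
      unfolding absolutely_integrable_on_Icc_iff_Ioo[symmetric]
      by (intro absolutely_integrable_continuous_real continuous_intros cont test_function_continuous(3)[OF \<phi>])
    have "(\<lambda>s. \<phi> s * g s) absolutely_integrable_on {a..b}"
      using test_function_continuous(2)[OF \<phi>, of "{a..b}"]
      by (intro absolutely_integrable_bounded_measurable_product_real g_int
          continuous_imp_measurable_on_sets_lebesgue compact_imp_bounded compact_continuous_image) auto
    then have 2: "set_integrable lebesgue {a<..<b} (\<lambda>s. g s * \<phi> s)"
      unfolding absolutely_integrable_on_Icc_iff_Ioo[symmetric] by (simp add: mult.commute)
    \<comment> \<open>The support lies inside the open interval, so the boundary terms vanish and
      \<open>q\<close> has integral zero.\<close>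
    have "a \<notin> K" "b \<notin> K" using K(2) by auto
    then have "\<phi> a = 0" "\<phi> b = 0" using K(3) by auto
    then have q0: "(q has_integral 0) {a<..<b}"
      using q[of a b] True by (simp add: has_integral_Icc_iff_Ioo)
    have "((\<lambda>s. u s * deriv \<phi> s + g s * \<phi> s) has_integral 0) {a<..<b}"
      by (rule has_integral_spike[OF negligible_Un[OF N1(1) N2(1)] _ q0]) (simp add: q_eq)
    then have "(LINT s:{a<..<b}|lebesgue. u s * deriv \<phi> s + g s * \<phi> s) = 0"
      using set_lebesgue_integral_eq_integral(2)[OF set_integral_add(1)[OF 1 2]] by (simp add: integral_unique)
    then show ?thesis using set_integral_add(2)[OF 1 2] by simp
  qed (simp add: set_lebesgue_integral_def)
qed

section \<open>Pointwise bounds from essential norms and superposition along a curve\<close>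

text \<open>A negative value would bound absolute values almost everywhere by a negative number, but
  the line is not null.\<close>

lemma Linf_norm_nonneg: "0 \<le> Linf_norm lebesgue f"
proof (rule ccontr)
  assume "\<not> ?thesis"
  then have "AE y in lebesgue. \<bar>ereal (f y)\<bar> \<le> Linf_norm lebesgue f \<and> Linf_norm lebesgue f < 0"
    using esssup_AE[of "\<lambda>y. ereal \<bar>f y\<bar>" lebesgue] by (simp add: Linf_norm_def)
  then have "AE y in lebesgue::real measure. False"
    by eventually_elim (metis abs_ereal_ge0 abs_ereal_pos leD order_trans)
  then show False
    using non_negligible_UNIV[where 'a = real]
    by (simp add: completion.AE_iff_null_sets negligible_iff_null_sets)
qed

text \<open>The set where a continuous function exceeds its essential bound is open and null, hence
  empty. This permits evaluation at the single point \<open>x t\<close>.\<close>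

lemma continuous_le_Linf_norm:
  assumes f: "continuous_on UNIV f"
  shows "ereal \<bar>f y\<bar> \<le> Linf_norm lebesgue f"
proof (rule ccontr)
  assume neg: "\<not> ?thesis"
  define U where "U = {z. Linf_norm lebesgue f < ereal \<bar>f z\<bar>}"
  have "open U"
    unfolding U_def using f
    by (intro open_Collect_less continuous_on_ereal continuous_intros) auto
  moreover have "y \<in> U" using neg by (simp add: U_def not_le)
  moreover have "AE z in lebesgue. z \<notin> U"
    using esssup_AE[of "\<lambda>z. ereal \<bar>f z\<bar>" lebesgue] by (simp add: Linf_norm_def U_def not_less)
  then have "negligible U"
    by (simp add: completion.AE_iff_null_sets negligible_iff_null_sets)
  ultimately show False using open_not_negligible by blast
qed

text \<open>The derivative part of the norm is nonnegative, so the supremum part alone is dominated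
  by the norm.\<close>

lemma continuous_le_W1inf_norm:
  assumes "continuous_on UNIV f"
  shows "ereal \<bar>f y\<bar> \<le> W1inf_norm f"
proof -
  have "0 \<le> (INF g\<in>{g. has_weak_derivative UNIV f g}. Linf_norm lebesgue g)"
    by (intro INF_greatest Linf_norm_nonneg)
  then have "Linf_norm lebesgue f + 0 \<le> W1inf_norm f"
    unfolding W1inf_norm_def by (rule add_left_mono)
  then show ?thesis using continuous_le_Linf_norm[OF assms, of y] by simp
qed

text \<open>Convergence in \<open>W1inf_norm\<close> implies pointwise convergence at
  \<open>x t\<close>, so the evaluation of \<open>l\<close> along \<open>x\<close> is almost
  everywhere a limit of measurable functions.\<close>

lemma Linf_W1inf_superposition:
  assumes l: "l \<in> Linf_W1inf T" and x: "continuous_on {0..T} x"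
  obtains h C where "h \<in> borel_measurable lebesgue" "0 \<le> C" "\<And>t. \<bar>h t\<bar> \<le> C"
    "AE t in lebesgue. t \<in> {0<..<T} \<longrightarrow> continuous_on UNIV (l t) \<and> h t = l t (x t)"
proof -
  let ?M = "lebesgue_on {0<..<T}"
  from l obtain C :: real and s where W: "AE t in ?M. l t \<in> W1inf"
    and C: "AE t in ?M. W1inf_norm (l t) \<le> ereal C"
    and simple: "\<And>n. simple_function ?M (s n)" and sW: "\<And>n. s n ` space ?M \<subseteq> W1inf"
    and lim: "AE t in ?M. (\<lambda>n. W1inf_norm (\<lambda>y. s n t y - l t y)) \<longlonglongrightarrow> 0"
    unfolding Linf_W1inf_def strongly_measurable_W1inf_def by blast
  have contW: "continuous_on UNIV u" if "u \<in> W1inf" for u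
    using that by (simp add: W1inf_def)
  have xm [measurable]: "x \<in> borel_measurable ?M"
    by (intro continuous_imp_measurable_on_sets_lebesgue continuous_on_subset[OF x]) auto
  have sm [measurable]: "(\<lambda>t. s n t (x t)) \<in> borel_measurable ?M" for n
  \<comment> \<open>A simple function has finitely many values \<open>u\<close>, each continuous, so
    every \<open>u (x t)\<close> is measurable in \<open>t\<close> and the pieces are glued along
    the level sets of \<open>s n\<close>.\<close>
  proof (rule measurable_compose_countable'[where f = "\<lambda>u t. u (x t)" and g = "s n" and I = "s n ` space ?M"])
    show "(\<lambda>t. u (x t)) \<in> borel_measurable ?M" if "u \<in> s n ` space ?M" for u
      using contW[of u] sW[of n] that
      by (intro measurable_compose[OF xm] borel_measurable_continuous_onI) auto
    show "s n \<in> ?M \<rightarrow>\<^sub>M count_space (s n ` space ?M)"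
      using simple[of n] by (auto simp: simple_function_def measurable_count_space_eq2)
    show "countable (s n ` space ?M)"
      using simple[of n] by (auto simp: simple_function_def intro: countable_finite)
  qed
  have "AE t in ?M. (\<lambda>n. s n t (x t)) \<longlonglongrightarrow> l t (x t)"
    using W lim AE_space
  proof eventually_elim
    case (elim t)
    have "s n t \<in> W1inf" for n using sW[of n] elim(3) by blast
    then have cont: "continuous_on UNIV (\<lambda>y. s n t y - l t y)" for n
      using elim(1) by (intro continuous_intros contW)
    have "(\<lambda>n. ereal \<bar>s n t (x t) - l t (x t)\<bar>) \<longlonglongrightarrow> 0"
      by (rule tendsto_sandwich[OF _ _ tendsto_const elim(2)])
        (auto intro!: always_eventually continuous_le_W1inf_norm[OF cont])
    then have "(\<lambda>n. \<bar>s n t (x t) - l t (x t)\<bar>) \<longlonglongrightarrow> 0"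
      by (simp add: zero_ereal_def)
    then show ?case
      by (simp add: tendsto_rabs_zero_iff LIM_zero_iff)
  qed
  then have limit: "AE t in ?M. lim (\<lambda>n. s n t (x t)) = l t (x t)"
    by eventually_elim (rule limI)
  \<comment> \<open>Truncation turns the almost everywhere bound into one for every
    \<open>t\<close>; the absolute value is taken because \<open>C\<close> is not known to be
    nonnegative.\<close>
  define h0 where "h0 t = (let y = lim (\<lambda>n. s n t (x t)) in if \<bar>y\<bar> \<le> \<bar>C\<bar> then y else 0)" for t
  have [measurable]: "h0 \<in> borel_measurable ?M" unfolding h0_def Let_def by measurable
  have h0: "AE t in ?M. continuous_on UNIV (l t) \<and> h0 t = l t (x t)"
    using W C limit
  proof eventually_elim
    case (elim t)
    have "ereal \<bar>l t (x t)\<bar> \<le> ereal C"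
      using continuous_le_W1inf_norm[OF contW[OF elim(1)], of "x t"] elim(2) by (rule order_trans)
    then show ?case using elim contW by (simp add: h0_def)
  qed
  show ?thesis
  proof
    show "(\<lambda>t. if t \<in> {0<..<T} then h0 t else 0) \<in> borel_measurable lebesgue"
      by (intro borel_measurable_if_I) auto
    show "\<bar>if t \<in> {0<..<T} then h0 t else 0\<bar> \<le> \<bar>C\<bar>" for t
      by (simp add: h0_def Let_def)
    show "AE t in lebesgue. t \<in> {0<..<T} \<longrightarrow> continuous_on UNIV (l t) \<and>
        (if t \<in> {0<..<T} then h0 t else 0) = l t (x t)"
      using h0 by (subst (asm) AE_restrict_space_iff) (auto elim!: eventually_mono)
  qed simp
qed

section \<open>Oriented integrals and everywhere bounded representatives\<close>

lemma interval_lebesgue_has_integral: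
  fixes f :: "real \<Rightarrow> real"
  assumes f: "\<And>a b. f absolutely_integrable_on {a..b}" and ab: "a \<le> b"
  shows "(f has_integral ((LINT y=ereal c..ereal b|lebesgue. f y) - (LINT y=ereal c..ereal a|lebesgue. f y))) {a..b}"
proof -
  have le: "(LINT y=ereal p..ereal q|lebesgue. f y) = integral {p..q} f" if "p \<le> q" for p q
    using that set_lebesgue_integral_eq_integral(2)[of "{p<..<q}" f] f[of p q]
    by (simp add: interval_lebesgue_integral_def absolutely_integrable_on_Icc_iff_Ioo integral_open_interval_real)
  have ge: "(LINT y=ereal q..ereal p|lebesgue. f y) = - integral {p..q} f" if "p \<le> q" for p q
    using le[OF that] that
    by (cases "p = q") (auto simp: interval_lebesgue_integral_def set_lebesgue_integral_def einterval_same)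
  have int: "f integrable_on {p..q}" for p q
    using f set_lebesgue_integral_eq_integral(1) by blast
  have comb: "integral {p..q} f + integral {q..r} f = integral {p..r} f" if "p \<le> q" "q \<le> r" for p q r
    using Henstock_Kurzweil_Integration.integral_combine[OF that int] .
  consider "c \<le> a" | "a \<le> c" "c \<le> b" | "b \<le> c" by linarith
  then have "(LINT y=ereal c..ereal b|lebesgue. f y) - (LINT y=ereal c..ereal a|lebesgue. f y) = integral {a..b} f"
    by cases (use ab comb[of c a b] comb[of a c b] comb[of a b c] in \<open>simp_all add: le ge\<close>)
  then show ?thesis using int[of a b] by (simp add: has_integral_integral)
qed

text \<open>Measurability passes from \<open>h\<close> to \<open>f\<close> on the interval by
  completeness of Lebesgue measure; \<open>min\<close> and \<open>max\<close> cover both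
  orientations.\<close>

lemma interval_lebesgue_integral_cong_lebesgue:
  fixes f h :: "real \<Rightarrow> real"
  assumes h: "h \<in> borel_measurable lebesgue"
    and eq: "AE y in lebesgue. y \<in> einterval (min a b) (max a b) \<longrightarrow> f y = h y"
  shows "(LINT y=a..b|lebesgue. f y) = (LINT y=a..b|lebesgue. h y)"
proof -
  have "(LINT y:einterval p q|lebesgue. f y) = (LINT y:einterval p q|lebesgue. h y)"
    if "AE y in lebesgue. y \<in> einterval p q \<longrightarrow> f y = h y" for p q
    unfolding set_lebesgue_integral_def
  proof (rule integral_cong_AE)
    show m: "(\<lambda>y. indicator (einterval p q) y *\<^sub>R h y) \<in> borel_measurable lebesgue"
      using h by (intro borel_measurable_scaleR borel_measurable_indicator) auto
    show ae: "AE y in lebesgue. indicator (einterval p q) y *\<^sub>R f y = indicator (einterval p q) y *\<^sub>R h y"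
      using that by eventually_elim (auto simp: indicator_def)
    show "(\<lambda>y. indicator (einterval p q) y *\<^sub>R f y) \<in> borel_measurable lebesgue"
      using ae by (intro borel_measurable_AE[OF m]) (auto elim!: eventually_mono)
  qed
  from this[of a b] this[of b a] eq show ?thesis
    by (cases "a \<le> b") (auto simp: interval_lebesgue_integral_def min_def max_def)
qed

lemma has_weak_derivative_cong:
  assumes eq: "\<And>s. s \<in> S \<Longrightarrow> u s = u' s" and S: "S \<in> sets lebesgue"
    and u: "has_weak_derivative S u g"
  shows "has_weak_derivative S u' g"
proof -
  have "set_integrable lebesgue K u = set_integrable lebesgue K u'" if "K \<subseteq> S" for K
    using that eq by (intro set_integrable_cong) auto
  moreover have "(LINT s:S|lebesgue. u s * d s) = (LINT s:S|lebesgue. u' s * d s)" for d :: "real \<Rightarrow> real"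
    by (rule set_lebesgue_integral_cong[OF S]) (simp add: eq)
  ultimately show ?thesis
    using u by (simp add: has_weak_derivative_def locally_integrable_def)
qed

lemma bounded_measurable_absolutely_integrable:
  fixes f :: "real \<Rightarrow> real"
  assumes "f \<in> borel_measurable lebesgue" "\<And>y. \<bar>f y\<bar> \<le> B"
  shows "f absolutely_integrable_on {a..b}"
  using assms
  by (intro measurable_bounded_by_integrable_imp_absolutely_integrable[where g = "\<lambda>_. B"])
    (auto intro: measurable_restrict_space1)

text \<open>All exceptional points of \<open>v\<close> are collected in one null set and the
  reciprocal is reset there, so that \<open>w\<close> has positive lower and upper bounds at every
  point.\<close>

lemma Linf_reciprocal:
  assumes v: "v \<in> Linf lebesgue" and "0 < vlow" and low: "AE y in lebesgue. vlow \<le> v y"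
  obtains w V N where "w \<in> borel_measurable lebesgue" "negligible N"
    "\<And>y. y \<notin> N \<Longrightarrow> w y * v y = 1 \<and> w y = 1 / v y \<and> \<bar>v y\<bar> \<le> V"
    "0 < V" "\<And>y. 1 / V \<le> w y" "\<And>y. w y \<le> 1 / vlow"
proof -
  have vm [measurable]: "v \<in> borel_measurable lebesgue" and fin: "Linf_norm lebesgue v < \<infinity>"
    using v by (auto simp: Linf_def)
  from fin Linf_norm_nonneg[of v] obtain B where B: "Linf_norm lebesgue v = ereal B" "B \<ge> 0"
    by (cases "Linf_norm lebesgue v") auto
  \<comment> \<open>The maximum makes \<open>V\<close> positive and keeps \<open>1 / V\<close> below
    \<open>1 / vlow\<close>, the default value of \<open>w\<close> on \<open>N\<close>.\<close>
  define V where "V = max B vlow"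
  have "AE y in lebesgue. \<bar>v y\<bar> \<le> V \<and> vlow \<le> v y"
    using esssup_AE[of "\<lambda>y. ereal \<bar>v y\<bar>" lebesgue] low
    by eventually_elim (use B in \<open>auto simp: Linf_norm_def V_def\<close>)
  then obtain N where N: "N \<in> null_sets lebesgue" "{y. \<not> (\<bar>v y\<bar> \<le> V \<and> vlow \<le> v y)} \<subseteq> N"
    by (auto simp: eventually_ae_filter)
  have N': "\<bar>v y\<bar> \<le> V \<and> vlow \<le> v y" if "y \<notin> N" for y using N(2) that by blast
  have [measurable]: "N \<in> sets lebesgue" using N by blast
  show ?thesis
  proof (rule that[of "\<lambda>y. if y \<in> N then 1 / vlow else 1 / v y" N V])
    show "(\<lambda>y. if y \<in> N then 1 / vlow else 1 / v y) \<in> borel_measurable lebesgue"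
      by measurable
    show "negligible N" using N by (simp add: negligible_iff_null_sets)
    show "0 < V" using \<open>0 < vlow\<close> by (simp add: V_def)
    show "1 / V \<le> (if y \<in> N then 1 / vlow else 1 / v y)" for y
      using N'[of y] \<open>0 < vlow\<close> by (auto simp: V_def intro!: frac_le)
    show "(if y \<in> N then 1 / vlow else 1 / v y) \<le> 1 / vlow" for y
      using N'[of y] \<open>0 < vlow\<close> by (auto intro!: frac_le)
    show "(if y \<in> N then 1 / vlow else 1 / v y) * v y = 1 \<and>
        (if y \<in> N then 1 / vlow else 1 / v y) = 1 / v y \<and> \<bar>v y\<bar> \<le> V" if "y \<notin> N" for y
      using N'[of y] that \<open>0 < vlow\<close> by auto
  qed
qed

section \<open>From the integral equation to the differential inclusion\<close>

theorem lemma2p2: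
  fixes T vlow x0 :: real and v :: "real \<Rightarrow> real" and l :: "real \<Rightarrow> real \<Rightarrow> real"
    and x :: "real \<Rightarrow> real"
  assumes "T > 0" and "vlow > 0"
    and "v \<in> Linf lebesgue" and "AE y in lebesgue. vlow \<le> v y"
    and "l \<in> Linf_W1inf T"
    and "integral_solution T v l x0 x"
  shows "filippov_solution T (\<lambda>t y. v y * l t y) x0 x"
proof -
  have x: "continuous_on {0..T} x"
    and sol: "\<And>t. t \<in> {0..T} \<Longrightarrow> (LINT y=ereal x0..ereal (x t)|lebesgue. (1 / v y))
                 = (LINT s=ereal 0..ereal t|lebesgue. l s (x s))"
    using assms(6) by (auto simp: integral_solution_def)
  obtain w V N where wm: "w \<in> borel_measurable lebesgue" and N: "negligible N"
    and wv: "\<And>y. y \<notin> N \<Longrightarrow> w y * v y = 1 \<and> w y = 1 / v y \<and> \<bar>v y\<bar> \<le> V"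
    and V: "0 < V" and wlow: "\<And>y. 1 / V \<le> w y" and whigh: "\<And>y. w y \<le> 1 / vlow"
    by (rule Linf_reciprocal[OF assms(3,2,4)]) blast
  obtain h C where hm: "h \<in> borel_measurable lebesgue" and C: "0 \<le> C" "\<And>t. \<bar>h t\<bar> \<le> C"
    and h: "AE t in lebesgue. t \<in> {0<..<T} \<longrightarrow> continuous_on UNIV (l t) \<and> h t = l t (x t)"
    by (rule Linf_W1inf_superposition[OF assms(5) x]) blast
  have wpos: "0 < w y" for y
    using wlow[of y] V by (meson divide_pos_pos less_le_trans zero_less_one)
  define W where "W z = (LINT y=ereal x0..ereal z|lebesgue. w y)" for z
  define G where "G t = (LINT s=ereal 0..ereal t|lebesgue. h s)" for t
  have W: "(w has_integral (W b - W a)) {a..b}" if "a \<le> b" for a b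
    unfolding W_def using wpos whigh that
    by (intro interval_lebesgue_has_integral bounded_measurable_absolutely_integrable[OF wm, of "1 / vlow"])
      (auto simp: less_imp_le)
  have G: "(h has_integral (G b - G a)) {a..b}" if "a \<le> b" for a b
    unfolding G_def using that C
    by (intro interval_lebesgue_has_integral bounded_measurable_absolutely_integrable[OF hm, of C]) auto
  \<comment> \<open>Both integrands are exchanged for the representatives \<open>w\<close> and
    \<open>h\<close>, which agree with them almost everywhere on the intervals of
    integration.\<close>
  have WG: "W (x t) = G t" if "t \<in> {0..T}" for t
  proof -
    have "W (x t) = (LINT y=ereal x0..ereal (x t)|lebesgue. (1 / v y))"
      unfolding W_def
    proof (rule interval_lebesgue_integral_cong_lebesgue[OF wm, symmetric])
      have "AE y in lebesgue. y \<notin> N"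
        using N by (simp add: AE_not_in negligible_iff_null_sets)
      then show "AE y in lebesgue. y \<in> einterval (min (ereal x0) (ereal (x t))) (max (ereal x0) (ereal (x t)))
          \<longrightarrow> 1 / v y = w y"
        by eventually_elim (use wv in auto)
    qed
    also have "\<dots> = (LINT s=ereal 0..ereal t|lebesgue. l s (x s))"
      using sol[OF that] .
    also have "\<dots> = G t"
      unfolding G_def
    proof (rule interval_lebesgue_integral_cong_lebesgue[OF hm])
      show "AE s in lebesgue. s \<in> einterval (min (ereal 0) (ereal t)) (max (ereal 0) (ereal t))
          \<longrightarrow> l s (x s) = h s"
        using h by eventually_elim (use that in \<open>auto simp: einterval_def min_def max_def split: if_splits\<close>)
    qed
    finally show ?thesis .
  qed
  \<comment> \<open>The lower bound \<open>1 / V\<close> on the density \<open>w\<close> makes the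
    inverse of \<open>W\<close> Lipschitz with constant \<open>V\<close>.\<close>
  have lipW: "\<bar>b - a\<bar> \<le> V * \<bar>W b - W a\<bar>" for a b
  proof -
    have *: "b - a \<le> V * (W b - W a)" if "a \<le> b" for a b
    proof -
      have "((\<lambda>_. 1 / V) has_integral (b - a) * (1 / V)) {a..b}"
        using has_integral_const_real[of "1 / V" a b] that by simp
      from has_integral_le[OF this W[OF that]] wlow have "(b - a) * (1 / V) \<le> W b - W a" by blast
      then show ?thesis using V by (simp add: field_simps)
    qed
    have "\<bar>b - a\<bar> \<le> V * \<bar>W b - W a\<bar>" if "a \<le> b" for a b
      using *[OF that] that V by (metis abs_of_nonneg abs_ge_self diff_ge_0_iff_ge mult_left_mono less_imp_le order_trans)
    from this[of a b] this[of b a] show ?thesis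
      by (cases "a \<le> b") (auto simp: abs_minus_commute)
  qed
  have lipG: "\<bar>G b - G a\<bar> \<le> C * \<bar>b - a\<bar>" for a b
  proof -
    have "\<bar>G b - G a\<bar> \<le> C * \<bar>b - a\<bar>" if "a \<le> b" for a b
      using has_integral_bound_real[OF C(1) finite.emptyI G[OF that]] C(2) that by simp
    from this[of a b] this[of b a] show ?thesis
      by (cases "a \<le> b") (auto simp: abs_minus_commute)
  qed
  \<comment> \<open>At time zero both integrals vanish, and injectivity of \<open>W\<close> yields
    the initial value.\<close>
  have x0: "x 0 = x0"
    using lipW[of "x 0" x0] WG[of 0] \<open>T > 0\<close>
    by (simp add: W_def G_def interval_lebesgue_integral_def set_lebesgue_integral_def einterval_same)
  \<comment> \<open>Clamping time extends \<open>x\<close> by constants to the whole line, where the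
    density and differentiation results apply; \<open>cl\<close> does not increase
    distances.\<close>
  define cl where "cl t = max 0 (min T t)" for t
  define xe where "xe t = x (cl t)" for t
  have cl: "cl t \<in> {0..T}" for t using \<open>T > 0\<close> by (auto simp: cl_def)
  have cl_id: "cl t = t" if "t \<in> {0..T}" for t using that by (auto simp: cl_def)
  have xe_lip: "(V * C)-lipschitz_on UNIV xe"
  proof (rule lipschitz_onI)
    fix a b :: real
    have "\<bar>xe a - xe b\<bar> \<le> V * \<bar>G (cl a) - G (cl b)\<bar>"
      using lipW[of "xe a" "xe b"] by (simp add: xe_def WG[OF cl])
    also have "\<dots> \<le> V * (C * \<bar>cl a - cl b\<bar>)"
      using lipG[of "cl a" "cl b"] V by (simp add: mult_left_mono)
    also have "\<dots> \<le> V * (C * \<bar>a - b\<bar>)"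
      using V C by (intro mult_left_mono) (auto simp: cl_def)
    finally show "dist (xe a) (xe b) \<le> V * C * dist a b"
      by (simp add: dist_real_def mult.assoc)
  qed (use V C in auto)
  obtain g where g: "\<And>a b. a \<le> b \<Longrightarrow> (g has_integral (xe b - xe a)) {a..b}"
    and g_int: "\<And>a b. g absolutely_integrable_on {a..b}"
    by (rule lipschitz_density[OF xe_lip]) blast
  obtain N1 where N1: "negligible N1" "\<And>t. t \<notin> N1 \<Longrightarrow> (xe has_real_derivative g t) (at t)"
    using ae_has_derivative_indefinite_integral[OF g] by blast
  obtain N2 where N2: "negligible N2" "\<And>t. t \<notin> N2 \<Longrightarrow> (G has_real_derivative h t) (at t)"
    using ae_has_derivative_indefinite_integral[OF G] by blast
  have hull: "g t \<in> filippov_hull (\<lambda>y. v y * l t y) (x t)"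
    if t: "t \<in> {0<..<T}" "t \<notin> N1" "t \<notin> N2" and lt: "continuous_on UNIV (l t)" "h t = l t (x t)" for t
  proof -
    have xt: "xe t = x t" using t(1) by (simp add: xe_def cl_id)
    \<comment> \<open>Near an interior \<open>t\<close> the composition coincides with
      \<open>G\<close>, so its derivative comes from the integral equation.\<close>
    have "((\<lambda>s. W (xe s)) has_real_derivative h t) (at t)"
    proof (rule has_field_derivative_transform_within_open[OF N2(2)[OF t(3)] open_greaterThanLessThan t(1)])
      show "G s = W (xe s)" if "s \<in> {0<..<T}" for s
        using that by (simp add: xe_def cl_id WG)
    qed
    then have Wxe: "((\<lambda>s. W (xe s)) has_real_derivative l t (xe t)) (at t)" using lt xt by simp
    have "g t \<in> filippov_hull (\<lambda>y. v y * l t y) (xe t)"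
    proof (rule derivative_in_filippov_hull[where W = W and p = xe and l = "l t" and v = v,
            OF W wpos N _ lipW N1(2)[OF t(2)] Wxe])
      show "isCont (l t) (xe t)" using lt(1) by (simp add: continuous_on_eq_continuous_at)
      show "w y * v y = 1 \<and> \<bar>v y\<bar> \<le> V" if "y \<notin> N" for y
        using wv[OF that] by blast
    qed
    then show ?thesis by (simp add: xt)
  qed
  have weak: "has_weak_derivative {0<..<T} x g"
    by (rule has_weak_derivative_cong[OF _ _ lipschitz_has_weak_derivative[OF xe_lip g g_int]])
      (auto simp: xe_def cl_id)
  have ae: "AE t in lebesgue_on {0..T}. g t \<in> filippov_hull (\<lambda>y. v y * l t y) (x t)"
  proof -
    \<comment> \<open>The endpoints join the null set, because the inclusion concerns
      \<open>{0..T}\<close> while \<open>h\<close> is identified only inside the open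
      interval.\<close>
    have "AE t in lebesgue. t \<notin> N1 \<union> N2 \<union> {0, T}"
    proof (rule AE_not_in)
      have "negligible (N1 \<union> N2 \<union> {0, T})" using N1(1) N2(1) by (intro negligible_Un) auto
      then show "N1 \<union> N2 \<union> {0, T} \<in> null_sets lebesgue" by (simp add: negligible_iff_null_sets)
    qed
    with h have "AE t in lebesgue. t \<in> {0..T} \<longrightarrow> g t \<in> filippov_hull (\<lambda>y. v y * l t y) (x t)"
      by eventually_elim (use hull in auto)
    then show ?thesis by (subst AE_restrict_space_iff) auto
  qed
  have "set_integrable lebesgue {0<..<T} x" "set_integrable lebesgue {0<..<T} g"
    using absolutely_integrable_continuous_real[OF x] g_int[of 0 T]
    by (simp_all add: absolutely_integrable_on_Icc_iff_Ioo)
  with x x0 weak ae show ?thesis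
    unfolding filippov_solution_def by blast
qed

end
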